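(* Let $k\in\mathbb{C}$ with $k\ne0$. For every integer $m\ge0$, $$\mu_{2m}(0,k)=k^mC_m,\qquad \mu_{2m+1}(0,k)=0,$$ where $C_m=\frac{1}{2m+1}\binom{2m+1}{m}$ is the $m$-th Catalan number.
   Context: Let $E_n(x)\in\mathbb{C}[x]$ be defined by $E_{-1}=0$, $E_0=1$, $E_n(x)=xE_{n-1}(x)-kE_{n-2}(x)$ for $n\ge1$ (Dickson polynomials of the second kind). Since $k\ne0$, by Favard's theorem there is a unique linear functional $\mathcal{V}:\mathbb{C}[x]\to\mathbb{C}$ with $\mathcal{V}[1]=1$ and $\mathcal{V}[E_mE_n]=0$ for $m\ne n$. The moments are $\mu_n(0,k)=\mathcal{V}[x^n]$. *)

theory Defs
  imports "HOL-Computational_Algebra.Polynomial"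
begin

text \<open>
  Dickson polynomials of the second kind. The convention \<open>E\<^sub>-\<^sub>1 = 0\<close> is absorbed into the
  second equation: \<open>E\<^sub>1 = x E\<^sub>0 - k E\<^sub>-\<^sub>1 = x\<close>.
\<close>
fun dickson_poly2 :: "complex \<Rightarrow> nat \<Rightarrow> complex poly" where
  "dickson_poly2 k 0 = 1"
| "dickson_poly2 k (Suc 0) = [:0, 1:]"
| "dickson_poly2 k (Suc (Suc n)) =
     [:0, 1:] * dickson_poly2 k (Suc n) - smult k (dickson_poly2 k n)"

definition dickson_orthogonality_functional ::
  "complex \<Rightarrow> (complex poly \<Rightarrow> complex) \<Rightarrow> bool" where
  "dickson_orthogonality_functional k V \<longleftrightarrow>
     Vector_Spaces.linear smult (*) V \<and> V 1 = 1 \<and>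
     (\<forall>m n. m \<noteq> n \<longrightarrow> V (dickson_poly2 k m * dickson_poly2 k n) = 0)"

text \<open>
  For \<open>k \<noteq> 0\<close> the description is proper by Favard's theorem. It is not assumed here, so
  evaluating the moments requires establishing existence and uniqueness of the functional.
\<close>
definition dickson_functional :: "complex \<Rightarrow> complex poly \<Rightarrow> complex" where
  "dickson_functional k = (THE V. dickson_orthogonality_functional k V)"

definition dickson_moment :: "complex \<Rightarrow> nat \<Rightarrow> complex" where
  "dickson_moment k n = dickson_functional k ([:0, 1:] ^ n)"

definition catalan :: "nat \<Rightarrow> complex" where
  "catalan m = 1 / of_nat (2 * m + 1) * of_nat ((2 * m + 1) choose m)"

end

theory Submission imports Defs begin

text \<open>
  Write \<open>E\<^sub>j\<close> for the Dickson polynomials and let \<open>V\<close> be linear. Two observations make the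
  moments computable.

  First, full orthogonality is equivalent to the much weaker condition \<open>V E\<^sub>0 = 1\<close> and
  \<open>V E\<^sub>j = 0\<close> for \<open>j > 0\<close>: as \<open>x E\<^sub>n = E\<^sub>n\<^sub>+\<^sub>1 + k E\<^sub>n\<^sub>-\<^sub>1\<close>, the numbers \<open>V (E\<^sub>m E\<^sub>n)\<close> obey a
  recurrence in \<open>m\<close> which these initial values turn into \<open>V (E\<^sub>m E\<^sub>n) = k\<^sup>n \<delta>\<^sub>m\<^sub>n\<close>
  (lemma \<open>dickson_product_value\<close>).

  Second, by the same relation, the mixed moments \<open>V (x\<^sup>n E\<^sub>j)\<close> obey the recurrence that counts
  lattice paths with \<open>n\<close> steps from height \<open>j\<close> down to height \<open>0\<close>, never going below \<open>0\<close>,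
  where each down step carries the weight \<open>k\<close>. Let \<open>path_weight k n j\<close> be that count. Read in
  one direction this determines all moments of \<open>V\<close>, hence \<open>V\<close> itself; read in the other, the
  functional with moments \<open>path_weight k n 0\<close> takes the required values on the \<open>E\<^sub>j\<close>, since
  \<open>path_weight k 0 j\<close> vanishes for \<open>j > 0\<close>. So the functional exists, is unique, and its
  moments are weighted Dyck path counts. The reflection principle evaluates them: a difference
  of two binomial coefficients, which for \<open>j = 0\<close> is the Catalan number.
\<close>

section \<open>Weighted lattice paths\<close>

text \<open>
  Total weight of the nonnegative paths with \<open>n\<close> unit steps from height \<open>j\<close> to height \<open>0\<close>, a
  step down weighing \<open>k\<close> and a step up weighing \<open>1\<close>; the equations split off the first step.
\<close>
fun path_weight :: "'a::comm_ring_1 \<Rightarrow> nat \<Rightarrow> nat \<Rightarrow> 'a" where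
  "path_weight k 0 j = (if j = 0 then 1 else 0)"
| "path_weight k (Suc n) 0 = path_weight k n 1"
| "path_weight k (Suc n) (Suc j) = path_weight k n (Suc (Suc j)) + k * path_weight k n j"

lemma path_weight_eq_0: "n < j \<or> odd (n + j) \<Longrightarrow> path_weight k n j = 0"
  by (induction k n j rule: path_weight.induct) (auto split: if_splits intro: odd_pos)

text \<open>
  The reflection principle: a path with \<open>i\<close> steps up has \<open>i + j\<close> steps down, and the
  unrestricted paths that do reach height \<open>-1\<close> correspond, by reflecting the part before the
  first such visit, to the paths from \<open>-j - 2\<close> to \<open>0\<close>, which have \<open>i + j + 1\<close> steps up. Choosing
  the positions of these, rather than of the \<open>i - 1\<close> steps down, avoids a truncated
  subtraction at \<open>i = 0\<close>. The recurrence becomes Pascal's rule.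
\<close>
lemma path_weight_closed_form:
  "path_weight k (j + 2 * i) j =
     k ^ (i + j) * (of_nat ((j + 2 * i) choose i) - of_nat ((j + 2 * i) choose (i + j + 1)))"
proof -
  have "path_weight k n j =
      k ^ (i + j) * (of_nat (n choose i) - of_nat (n choose (i + j + 1)))"
    if "n = j + 2 * i" for n
    using that
  proof (induction n arbitrary: i j)
    case 0
    then show ?case by simp
  next
    case (Suc n)
    show ?case
    proof (cases j)
      case 0
      with Suc.prems obtain i' where i: "i = Suc i'" "n = 1 + 2 * i'"
        by (cases i) auto
      show ?thesis
        using Suc.IH[OF i(2)] 0 i(1) by simp
    next
      case (Suc j')
      show ?thesis
      proof (cases i)
        case 0
        with Suc Suc.prems have n: "n = j'" by simp
        show ?thesis
          using Suc.IH[of j' 0] 0 Suc n by (simp add: path_weight_eq_0 binomial_eq_0)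
      next
        case i: (Suc i')
        have 1: "n = Suc (Suc j') + 2 * i'" and 2: "n = j' + 2 * Suc i'"
          using Suc i Suc.prems by simp_all
        show ?thesis
          unfolding Suc i path_weight.simps Suc.IH[OF 1] Suc.IH[OF 2]
          by (simp add: algebra_simps)
      qed
    qed
  qed
  then show ?thesis by simp
qed

lemma catalan_eq_binomial_diff:
  "catalan m = of_nat ((2 * m) choose m) - of_nat ((2 * m) choose (m + 1))"
proof -
  have a: "Suc m * (Suc (2 * m) choose m) = Suc (2 * m) * ((2 * m) choose m)"
    using Suc_times_binomial[of m "2 * m"] binomial_symmetric[of m "Suc (2 * m)"]
    by (simp add: Suc_diff_le)
  have b: "Suc m * ((2 * m) choose (Suc m)) = m * ((2 * m) choose m)"
    using trans[OF binomial_absorption binomial_absorb_comp[symmetric], of m "2 * m"] by simp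
  have a': "of_nat (Suc m) * of_nat (Suc (2 * m) choose m)
      = of_nat (Suc (2 * m)) * (of_nat ((2 * m) choose m) :: complex)"
    using a by (metis of_nat_mult)
  have b': "of_nat (Suc m) * of_nat ((2 * m) choose (Suc m))
      = of_nat m * (of_nat ((2 * m) choose m) :: complex)"
    using b by (metis of_nat_mult)
  have nz: "of_nat (Suc m) \<noteq> (0::complex)" "of_nat (Suc (2 * m)) \<noteq> (0::complex)"
    by (simp_all only: of_nat_eq_0_iff)
  have "of_nat (Suc m) * catalan m = of_nat ((2 * m) choose m)"
    using a' nz unfolding catalan_def
    by (simp add: field_simps del: of_nat_Suc binomial_Suc_Suc)
  also have "\<dots> = of_nat (Suc m) *
      (of_nat ((2 * m) choose m) - of_nat ((2 * m) choose (m + 1)))"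
    using b' by (simp add: algebra_simps)
  finally show ?thesis using nz(1) by simp
qed

section \<open>Linear functionals and the Dickson recurrence\<close>

lemma vector_space_poly: "vector_space (smult :: 'a::field \<Rightarrow> _)"
  by unfold_locales (simp_all add: smult_add_right smult_add_left)

lemma linear_functional_iff:
  "Vector_Spaces.linear smult (*) V \<longleftrightarrow>
     (\<forall>p q. V (p + q) = V p + V q) \<and> (\<forall>c p. V (smult c p) = (c::'a::field) * V p)"
proof -
  have "vector_space ((*) :: 'a \<Rightarrow> _)"
    by unfold_locales (simp_all add: algebra_simps)
  then show ?thesis
    using vector_space_poly[where 'a = 'a]
    by (auto simp: Vector_Spaces.linear_def module_hom_def module_hom_axioms_def
        module_def vector_space_def)
qed

lemma linear_functional_diff:
  assumes "Vector_Spaces.linear smult (*) V"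
  shows "V (p - q) = V p - V (q :: 'a::field poly)"
  using assms unfolding linear_functional_iff
  by (metis add_diff_cancel_right' diff_add_cancel)

lemma linear_functional_by_moments:
  assumes "Vector_Spaces.linear smult (*) V"
  shows "V p = (\<Sum>i\<le>degree p. coeff p i * V ([:0, 1 :: 'a::field:] ^ i))"
proof -
  note L = assms[unfolded linear_functional_iff]
  have V0: "V 0 = 0"
    using L by (metis mult_zero_left smult_0_left)
  have "V (\<Sum>i\<in>A. f i) = (\<Sum>i\<in>A. V (f i))" if "finite A" for A :: "nat set" and f
    using that by (induction A rule: finite_induct) (use L V0 in auto)
  then have "V (\<Sum>i\<le>degree p. monom (coeff p i) i) = (\<Sum>i\<le>degree p. V (monom (coeff p i) i))"
    by simp
  also have "\<dots> = (\<Sum>i\<le>degree p. coeff p i * V ([:0, 1:] ^ i))"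
    using L by (simp add: monom_altdef)
  finally show ?thesis by (simp add: poly_as_sum_of_monoms)
qed

text \<open>
  Multiplication by \<open>x\<close> may be absorbed into either factor; applying
  \<open>E\<^sub>m\<^sub>+\<^sub>2 = x E\<^sub>m\<^sub>+\<^sub>1 - k E\<^sub>m\<close> to the left factor and \<open>x E\<^sub>n = E\<^sub>n\<^sub>+\<^sub>1 + k E\<^sub>n\<^sub>-\<^sub>1\<close> to the right one
  expresses \<open>V (E\<^sub>m\<^sub>+\<^sub>2 E\<^sub>n)\<close> through values with left index \<open>m + 1\<close> or \<open>m\<close>.
\<close>
lemma dickson_product_value:
  assumes lin: "Vector_Spaces.linear smult (*) V"
    and V: "\<And>j. V (dickson_poly2 k j) = (if j = 0 then 1 else 0)"
  shows "V (dickson_poly2 k m * dickson_poly2 k n) = (if m = n then k ^ n else 0)"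
proof (induction m arbitrary: n rule: induct_nat_012)
  case 0
  then show ?case using V[of n] by simp
next
  case 1
  show ?case
  proof (cases n)
    case 0
    then show ?thesis using V[of 1] by simp
  next
    case (Suc n')
    have "dickson_poly2 k (Suc 0) * dickson_poly2 k n =
        dickson_poly2 k (Suc (Suc n')) + smult k (dickson_poly2 k n')"
      using Suc by simp
    then have "V (dickson_poly2 k (Suc 0) * dickson_poly2 k n) =
        V (dickson_poly2 k (Suc (Suc n'))) + k * V (dickson_poly2 k n')"
      using lin unfolding linear_functional_iff by metis
    then show ?thesis using V[of "Suc (Suc n')"] V[of n'] Suc by simp
  qed
next
  case (ge2 m)
  let ?E = "dickson_poly2 k"
  show ?case
  proof (cases n)
    case 0
    then show ?thesis using V[of "Suc (Suc m)"] by simp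
  next
    case (Suc n')
    have "?E (Suc (Suc m)) * ?E n =
        (?E (Suc m) * ?E (Suc n) + smult k (?E (Suc m) * ?E n')) - smult k (?E m * ?E n)"
      using Suc by (simp add: algebra_simps smult_diff_right)
    then have "V (?E (Suc (Suc m)) * ?E n) =
        V (?E (Suc m) * ?E (Suc n)) + k * V (?E (Suc m) * ?E n') - k * V (?E m * ?E n)"
      using lin linear_functional_diff[OF lin] unfolding linear_functional_iff by metis
    then show ?thesis using ge2.IH Suc by (simp del: dickson_poly2.simps)
  qed
qed

lemma mixed_moment_step:
  assumes "Vector_Spaces.linear smult (*) V"
  shows "V ([:0, 1:] ^ Suc n * dickson_poly2 k (Suc j)) =
    V ([:0, 1:] ^ n * dickson_poly2 k (Suc (Suc j))) + k * V ([:0, 1:] ^ n * dickson_poly2 k j)"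
proof -
  have "[:0, 1:] ^ Suc n * dickson_poly2 k (Suc j) =
      [:0, 1:] ^ n * dickson_poly2 k (Suc (Suc j)) + smult k ([:0, 1:] ^ n * dickson_poly2 k j)"
    by (simp add: algebra_simps)
  then show ?thesis
    using assms unfolding linear_functional_iff by metis
qed

lemma mixed_moment_step_0:
  "[:0, 1:] ^ Suc n * dickson_poly2 k 0 = [:0, 1:] ^ n * dickson_poly2 k (Suc 0)"
  by (simp add: mult.commute)

lemma mixed_moments_from_dickson_values:
  assumes lin: "Vector_Spaces.linear smult (*) V"
    and V: "\<And>j. V (dickson_poly2 k j) = (if j = 0 then 1 else 0)"
  shows "V ([:0, 1:] ^ n * dickson_poly2 k j) = path_weight k n j"
proof (induction n arbitrary: j)
  case 0
  then show ?case using V by simp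
next
  case (Suc n)
  show ?case
  proof (cases j)
    case 0
    then show ?thesis
      using Suc.IH[of 1] by (simp only: mixed_moment_step_0 path_weight.simps One_nat_def)
  next
    case (Suc j')
    then show ?thesis by (simp only: mixed_moment_step[OF lin] Suc.IH path_weight.simps)
  qed
qed

text \<open>
  Solved for \<open>V (x\<^sup>n E\<^sub>j\<^sub>+\<^sub>2)\<close>, the term with the largest index, the recurrence leads from the
  pure moments at \<open>j = 0\<close> to all larger \<open>j\<close>, at the price of a larger exponent. The case of interest is \<open>n = 0\<close>, the values on the \<open>E\<^sub>j\<close>.
\<close>
lemma mixed_moments_from_moments:
  assumes lin: "Vector_Spaces.linear smult (*) V"
    and V: "\<And>n. V ([:0, 1:] ^ n) = path_weight k n 0"
  shows "V ([:0, 1:] ^ n * dickson_poly2 k j) = path_weight k n j"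
proof (induction j arbitrary: n rule: induct_nat_012)
  case 0
  then show ?case using V by simp
next
  case 1
  show ?case using V[of "Suc n"] by (simp add: mult.commute)
next
  case (ge2 j)
  show ?case
    using mixed_moment_step[OF lin, of n k j] ge2.IH(1)[of n] ge2.IH(2)[of "Suc n"]
    by (simp del: power_Suc dickson_poly2.simps)
qed

section \<open>Existence, uniqueness and the moments\<close>

text \<open>
  Both sides are compared through the values on the \<open>E\<^sub>j\<close>: orthogonality against \<open>E\<^sub>0 = 1\<close>
  alone already gives them, and they give back all products.
\<close>
lemma dickson_orthogonality_functional_iff:
  "dickson_orthogonality_functional k V \<longleftrightarrow> Vector_Spaces.linear smult (*) V \<and>
     (\<forall>n. V ([:0, 1:] ^ n) = path_weight k n 0)"
  (is "?L \<longleftrightarrow> ?R")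
proof
  assume ?L
  then have lin: "Vector_Spaces.linear smult (*) V" and one: "V 1 = 1"
    and orth: "\<And>m n. m \<noteq> n \<Longrightarrow> V (dickson_poly2 k m * dickson_poly2 k n) = 0"
    unfolding dickson_orthogonality_functional_def by auto
  have "V (dickson_poly2 k j) = (if j = 0 then 1 else 0)" for j
    using orth[of j 0] one by simp
  then show ?R
    using mixed_moments_from_dickson_values[OF lin, of k _ 0] lin by simp
next
  assume ?R
  then have lin: "Vector_Spaces.linear smult (*) V"
    and mom: "\<And>n. V ([:0, 1:] ^ n) = path_weight k n 0"
    by auto
  have "V (dickson_poly2 k j) = (if j = 0 then 1 else 0)" for j
    using mixed_moments_from_moments[OF lin mom, of 0 j] by simp
  then show ?L
    using dickson_product_value[OF lin, of k] mom[of 0] lin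
    unfolding dickson_orthogonality_functional_def by simp
qed

lemma linear_functional_with_moments:
  obtains V where "Vector_Spaces.linear smult (*) V"
    and "\<And>n. V ([:0, 1 :: 'a::field:] ^ n) = a n"
proof -
  define V where "V p = (\<Sum>i\<le>degree p. coeff p i * a i)" for p :: "'a poly"
  \<comment> \<open>The summation bound may be raised, so that two polynomials can share one.\<close>
  have V: "V p = (\<Sum>i\<le>N. coeff p i * a i)" if "degree p \<le> N" for p N
    unfolding V_def using that
    by (intro sum.mono_neutral_left) (auto simp: coeff_eq_0)
  have "V (p + q) = V p + V q" for p q
    using V[of p "max (degree p) (degree q)"] V[of q "max (degree p) (degree q)"]
      V[OF degree_add_le_max[of p q]]
    by (simp add: sum.distrib distrib_right)
  moreover have "V (smult c p) = c * V p" for c p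
    using V[OF degree_smult_le[of c p]] V[of p "degree p"]
    by (simp add: sum_distrib_left mult.assoc)
  ultimately have "Vector_Spaces.linear smult (*) V"
    unfolding linear_functional_iff by blast
  moreover have "V ([:0, 1:] ^ n) = a n" for n
  proof -
    have "[:0, 1:] ^ n = (monom 1 n :: 'a poly)"
      by (simp add: monom_altdef)
    then show ?thesis
      by (simp add: V_def degree_monom_eq if_distrib[of "\<lambda>c. c * _"] cong: if_cong)
  qed
  ultimately show thesis by (rule that)
qed

lemma dickson_moment_eq_path_weight: "dickson_moment k n = path_weight k n 0"
proof -
  obtain V where lin: "Vector_Spaces.linear smult (*) V"
    and mom: "\<And>n. V ([:0, 1:] ^ n) = path_weight k n 0"
    using linear_functional_with_moments[of "\<lambda>n. path_weight k n 0"] by blast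
  have V: "dickson_orthogonality_functional k V"
    using lin mom by (simp add: dickson_orthogonality_functional_iff)
  have "W = V" if "dickson_orthogonality_functional k W" for W
  proof
    fix p
    from that have W: "Vector_Spaces.linear smult (*) W"
      "\<And>n. W ([:0, 1:] ^ n) = path_weight k n 0"
      by (auto simp: dickson_orthogonality_functional_iff)
    then show "W p = V p"
      using linear_functional_by_moments[OF W(1), of p]
        linear_functional_by_moments[OF lin, of p] mom by simp
  qed
  with V have "dickson_functional k = V"
    unfolding dickson_functional_def by (rule the_equality)
  with mom show ?thesis
    by (simp add: dickson_moment_def)
qed

theorem mainTheorem14:
  fixes k :: complex and m :: nat
  assumes "k \<noteq> 0"
  shows "dickson_moment k (2 * m) = k ^ m * catalan m \<and> dickson_moment k (2 * m + 1) = 0"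
  using path_weight_closed_form[of k 0 m]
  by (simp add: dickson_moment_eq_path_weight catalan_eq_binomial_diff path_weight_eq_0)

end
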